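(* Let $A\in\mathbb{R}^{n\times n}$ be symmetric positive definite, $b\in\mathbb{R}^n$, $f(x)=\tfrac12x^\top Ax-b^\top x$, and let $x^\star$ be the unique minimiser of $f$ over $\{x\ge 0\}$. For $\mathcal F\subseteq\{1,\dots,n\}$ let $\hat x(\mathcal F)\in\mathbb{R}^n$ be the solution of $A_{\mathcal F}x_{\mathcal F}=b_{\mathcal F}$ extended by zeros, and let $\hat s(\mathcal F)=A\hat x(\mathcal F)-b$. Fix $p_{\max}\in\mathbb{N}$ and let $\mathcal F_0=\{1,\dots,n\},\mathcal F_1,\dots,\mathcal F_T$ be the (finite) sequence of free sets visited by the guarded active-set loop (defined in the context) run with exact inner solves. Define the decision margin $$\mu=\min_{0\le t\le T}\min\Big(\{|\hat x_i(\mathcal F_t)|: i\in\mathcal F_t,\ \hat x_i(\mathcal F_t)\ne0\}\cup\{|\hat s_i(\mathcal F_t)|: i\notin\mathcal F_t,\ \hat s_i(\mathcal F_t)\neq 0\}\Big)>0 .$$ Suppose that $0<\varepsilon<\mu$ and that in the inexact loop with test tolerance $\varepsilon$ (same $p_{\max}$, same initial free set) every inner solve on a free set $\mathcal F$ returns some $\tilde x_{\mathcal F}$ whose residual $\rho=\|b_{\mathcal F}-A_{\mathcal F}\tilde x_{\mathcal F}\|_2$ satisfies $$\rho\left(\frac{1+\lambda_{\max}(A)}{\lambda_{\min}(A)}\right)<\min(\varepsilon,\ \mu-\varepsilon).$$ Then at every outer step the violator sets $\mathcal D,\mathcal V$ computed by the inexact loop coincide with those computed from the exact solve on the same free set. Consequently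 the inexact loop visits exactly the free sets $\mathcal F_0,\dots,\mathcal F_T$, in this order, and stops at step $T$; in particular it terminates after finitely many outer steps. The returned iterate $\tilde x$ satisfies $\|\tilde x-x^\star\|_2\le\rho/\lambda_{\min}(A)$, and hence also $\|\tilde x-x^\star\|_\infty\le\rho/\lambda_{\min}(A)$, where $\rho$ is the residual of the final inner solve.
   Context: $A_{\mathcal F}$ is the principal submatrix of $A$ indexed by $\mathcal F$, $b_{\mathcal F}$ the corresponding subvector; $\lambda_{\min}(A),\lambda_{\max}(A)$ are the extreme eigenvalues of $A$. The minimum of an empty set is $+\infty$. Guarded active-set loop with patience budget $p_{\max}$ and test tolerance $\varepsilon\ge 0$. The state consists of a free set $\mathcal F$, a number $\bar N$ and a counter $q$, initialised as $\mathcal F=\{1,\dots,n\}$, $\bar N=n+1$, $q=p_{\max}$. Each outer iteration does the following. 1. Perform the inner solve on $\mathcal F$: obtain a vector $x_{\mathcal F}$, extend it to $x\in\mathbb{R}^n$ by $x_i=0$ for $i\notin\mathcal F$, and set $s=Ax-b$. In the exact loop $x=\hat x(\mathcal F)$ and $s=\hat s(\mathcal F)$; in the inexact loop $x_{\mathcal F}=\tilde x_{\mathcal F}$ is an approximate solution of $A_{\mathcal F}x_{\mathcal F}=b_{\mathcal F}$. 2. Form the violator sets $\mathcal D=\{i\in\mathcal F: x_i<-\varepsilon\}$ and $\mathcal V=\{i\notin\mathcal F: s_i<-\varepsilon\}$, and $N=|\mathcal D\cup\mathcal V|$. 3. If $N=0$, stop and return $x$. 4. Else if $N<\bar N$: set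 $\bar N\leftarrow N$, $q\leftarrow p_{\max}$, and $\mathcal F\leftarrow(\mathcal F\setminus\mathcal D)\cup\mathcal V$. 5. Else if $q>0$: set $q\leftarrow q-1$ and $\mathcal F\leftarrow(\mathcal F\setminus\mathcal D)\cup\mathcal V$. 6. Else: let $i^\star=\min(\mathcal D\cup\mathcal V)$; if $i^\star\in\mathcal D$ set $\mathcal F\leftarrow\mathcal F\setminus\{i^\star\}$, otherwise set $\mathcal F\leftarrow\mathcal F\cup\{i^\star\}$. The exact loop uses tolerance $0$ in step 2, i.e. its violator sets are $\{i\in\mathcal F:\hat x_i(\mathcal F)<0\}$ and $\{i\notin\mathcal F:\hat s_i(\mathcal F)<0\}$. It is known that the exact loop terminates after finitely many outer iterations and returns $x^\star$. *)

theory Defs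
  imports "HOL-Analysis.Analysis"
begin

text \<open>
  The index set {1, ..., n} is a finite linearly ordered type \<open>'n\<close>, so \<open>n = CARD('n)\<close>;
  the order is used only for the least-index rule of the loop.
\<close>

type_synonym 'n rvec = "real^'n"
type_synonym 'n rmat = "real^'n^'n"

definition spd :: "('n::finite) rmat \<Rightarrow> bool" where
  "spd A \<longleftrightarrow> transpose A = A \<and> (\<forall>x. x \<noteq> 0 \<longrightarrow> 0 < x \<bullet> (A *v x))"

definition eigenvalues :: "('n::finite) rmat \<Rightarrow> real set" where
  "eigenvalues A = {l. \<exists>v. v \<noteq> 0 \<and> A *v v = l *\<^sub>R v}"

definition lambda_min :: "('n::finite) rmat \<Rightarrow> real" where
  "lambda_min A = Min (eigenvalues A)"

definition lambda_max :: "('n::finite) rmat \<Rightarrow> real" where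
  "lambda_max A = Max (eigenvalues A)"

definition quad_obj :: "('n::finite) rmat \<Rightarrow> 'n rvec \<Rightarrow> 'n rvec \<Rightarrow> real" where
  "quad_obj A b x = 1/2 * (x \<bullet> (A *v x)) - b \<bullet> x"

definition is_nonneg_minimiser :: "('n::finite) rmat \<Rightarrow> 'n rvec \<Rightarrow> 'n rvec \<Rightarrow> bool" where
  "is_nonneg_minimiser A b = is_arg_min (quad_obj A b) (\<lambda>x. \<forall>i. 0 \<le> x $ i)"

definition nonneg_minimiser :: "('n::finite) rmat \<Rightarrow> 'n rvec \<Rightarrow> 'n rvec" where
  "nonneg_minimiser A b = (THE x. is_nonneg_minimiser A b x)"


text \<open>
  A subvector \<open>x\<^sub>F\<close> is represented by a full vector of which only the entries with index in \<open>F\<close>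
  are read. In particular \<open>principal_mult A F y i\<close> is the entry \<open>i\<close> of \<open>A\<^sub>F y\<^sub>F\<close>, meaningful
  for \<open>i \<in> F\<close>.
\<close>

definition zero_ext :: "('n::finite) set \<Rightarrow> 'n rvec \<Rightarrow> 'n rvec" where
  "zero_ext F y = (\<chi> i. if i \<in> F then y $ i else 0)"

definition principal_mult :: "('n::finite) rmat \<Rightarrow> 'n set \<Rightarrow> 'n rvec \<Rightarrow> 'n \<Rightarrow> real" where
  "principal_mult A F y i = (\<Sum>j\<in>F. A $ i $ j * y $ j)"

definition xhat :: "('n::finite) rmat \<Rightarrow> 'n rvec \<Rightarrow> 'n set \<Rightarrow> 'n rvec" where
  "xhat A b F = (THE x. (\<forall>i\<in>F. principal_mult A F x i = b $ i) \<and> (\<forall>i. i \<notin> F \<longrightarrow> x $ i = 0))"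

definition shat :: "('n::finite) rmat \<Rightarrow> 'n rvec \<Rightarrow> 'n set \<Rightarrow> 'n rvec" where
  "shat A b F = A *v xhat A b F - b"

definition residual :: "('n::finite) rmat \<Rightarrow> 'n rvec \<Rightarrow> 'n set \<Rightarrow> 'n rvec \<Rightarrow> real" where
  "residual A b F y = L2_set (\<lambda>i. b $ i - principal_mult A F y i) F"


definition drop_violators :: "real \<Rightarrow> ('n::finite) set \<Rightarrow> 'n rvec \<Rightarrow> 'n set" where
  "drop_violators eps F x = {i. i \<in> F \<and> x $ i < - eps}"

definition add_violators :: "real \<Rightarrow> ('n::finite) set \<Rightarrow> 'n rvec \<Rightarrow> 'n set" where
  "add_violators eps F s = {i. i \<notin> F \<and> s $ i < - eps}"

record 'n loop_state =
  free :: "'n set"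
  best :: nat
  budget :: nat

definition init_state :: "nat \<Rightarrow> 'n::finite loop_state" where
  "init_state pmax = \<lparr>free = UNIV, best = CARD('n) + 1, budget = pmax\<rparr>"

text \<open>\<open>None\<close> means that the loop stops in this iteration.\<close>

definition next_state ::
    "nat \<Rightarrow> ('n::{finite,linorder}) set \<Rightarrow> 'n set \<Rightarrow> 'n loop_state \<Rightarrow> 'n loop_state option" where
  "next_state pmax D V st =
    (let N = card (D \<union> V) in
     if N = 0 then None
     else if N < best st then
       Some \<lparr>free = (free st - D) \<union> V, best = N, budget = pmax\<rparr>
     else if budget st > 0 then
       Some \<lparr>free = (free st - D) \<union> V, best = best st, budget = budget st - 1\<rparr>
     else
       (let i = Min (D \<union> V) in
        Some \<lparr>free = (if i \<in> D then free st - {i} else free st \<union> {i}),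
              best = best st, budget = budget st\<rparr>))"

text \<open>
  \<open>solve t F\<close> is the vector returned by the inner solve of outer iteration \<open>t\<close> on the free set \<open>F\<close>.
  It may depend on \<open>t\<close>: two solves on the same free set need not return the same vector.
  \<open>run A b eps pmax solve t\<close> is the state at the start of outer iteration \<open>t\<close>, and \<open>None\<close> if
  the loop has stopped in an earlier iteration.
\<close>

primrec run ::
    "('n::{finite,linorder}) rmat \<Rightarrow> 'n rvec \<Rightarrow> real \<Rightarrow> nat \<Rightarrow> (nat \<Rightarrow> 'n set \<Rightarrow> 'n rvec) \<Rightarrow>
     nat \<Rightarrow> 'n loop_state option" where
  "run A b eps pmax solve 0 = Some (init_state pmax)"
| "run A b eps pmax solve (Suc t) =
    (case run A b eps pmax solve t of
       None \<Rightarrow> None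
     | Some st \<Rightarrow>
        (let F = free st;
             x = zero_ext F (solve t F);
             s = A *v x - b
         in next_state pmax (drop_violators eps F x) (add_violators eps F s) st))"

definition exact_run ::
    "('n::{finite,linorder}) rmat \<Rightarrow> 'n rvec \<Rightarrow> nat \<Rightarrow> nat \<Rightarrow> 'n loop_state option" where
  "exact_run A b pmax = run A b 0 pmax (\<lambda>_ F. xhat A b F)"

text \<open>The last outer iteration T of the exact loop, and the free sets it visits.\<close>

definition exact_stop :: "('n::{finite,linorder}) rmat \<Rightarrow> 'n rvec \<Rightarrow> nat \<Rightarrow> nat" where
  "exact_stop A b pmax = (LEAST t. exact_run A b pmax (Suc t) = None)"

definition exact_free :: "('n::{finite,linorder}) rmat \<Rightarrow> 'n rvec \<Rightarrow> nat \<Rightarrow> nat \<Rightarrow> 'n set" where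
  "exact_free A b pmax t = free (the (exact_run A b pmax t))"

text \<open>
  The margin is the minimum of a finite set; it is taken as an infimum in the extended reals so that
  it is \<open>\<infinity>\<close> if there are no nonzero entries (for example if \<open>b = 0\<close>).
\<close>

definition decision_margin :: "('n::{finite,linorder}) rmat \<Rightarrow> 'n rvec \<Rightarrow> nat \<Rightarrow> ereal" where
  "decision_margin A b pmax =
    (INF t\<in>{0..exact_stop A b pmax}.
      let F = exact_free A b pmax t in
      Inf ({ereal \<bar>xhat A b F $ i\<bar> |i. i \<in> F \<and> xhat A b F $ i \<noteq> 0} \<union>
           {ereal \<bar>shat A b F $ i\<bar> |i. i \<notin> F \<and> shat A b F $ i \<noteq> 0}))"

end

theory Submission
  imports Defs
begin

text \<open>
  Attach to a free set \<open>F\<close> the vector whose entries inside \<open>F\<close> are those of \<open>xhat A b F\<close> and whose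
  entries outside are those of \<open>shat A b F\<close>; call its entries the decision values
  (\<open>decision_value\<close>). The exact loop moves the indices whose decision value is negative, and each
  nonzero decision value that it meets has absolute value at least the margin \<open>mu\<close>.

  \<^emph>\<open>Same decisions.\<close> Let \<open>e\<close> be the error of an inexact solve on \<open>F\<close> with residual \<open>rho\<close>. It vanishes
  outside \<open>F\<close>, and inside \<open>F\<close> the entries of \<open>A e\<close> are the residual entries up to sign, so
  \<open>lambda_min * |e|^2 \<le> e \<bullet> (A e) \<le> |e| * rho\<close>. Hence \<open>|e| \<le> rho / lambda_min\<close>
  (\<open>norm_error_le_residual\<close>), and \<open>|A e| \<le> lambda_max * rho / lambda_min\<close>. Both errors stay below
  \<open>min eps (mu - eps)\<close>. A decision value that is nonnegative therefore stays above \<open>- eps\<close>, and a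
  negative one, being at most \<open>- mu\<close>, falls below \<open>- eps\<close>: the inexact tests give the exact answers
  (\<open>inexact_violators_eq\<close>), and by induction on the iterations the two loops pass through the same
  states (\<open>inexact_run_eq_exact_run\<close>).

  \<^emph>\<open>Termination of the exact loop.\<close> The pair (best violator count, remaining budget) decreases
  lexicographically in every block step, so an infinite run would eventually consist of
  least-index steps only. This is Murty's principal pivoting rule for a linear complementarity
  problem, which cannot go on for ever. Let \<open>m\<close> be the largest index moved infinitely often. It enters at
  some free set \<open>F\<close> and leaves at some \<open>G\<close>, where \<open>F\<close> and \<open>G\<close> agree above \<open>m\<close> and have nonnegative
  decision values below \<open>m\<close>. Comparing signs index by index shows
  \<open>(xhat F - xhat G) \<bullet> (shat F - shat G) < 0\<close>, although this product is
  \<open>(xhat F - xhat G) \<bullet> A (xhat F - xhat G) \<ge> 0\<close>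
  (\<open>least_violator_cannot_enter_and_leave\<close>).

  \<^emph>\<open>Optimality.\<close> When no decision value is negative, \<open>xhat\<close> and \<open>shat\<close> satisfy the
  Karush-Kuhn-Tucker conditions, so \<open>xhat\<close> is the unique minimiser. Termination thus also supplies
  the existence of the minimiser, and the error bound above, applied to the last free set, is the
  bound on the returned iterate.
\<close>

section \<open>Extreme eigenvalues of a symmetric matrix\<close>

lemma symmetric_inner_matrix_vector:
  fixes A :: "real^'n^'n"
  assumes "transpose A = A"
  shows "x \<bullet> (A *v y) = (A *v x) \<bullet> y"
  by (metis assms dot_lmul_matrix transpose_matrix_vector)

lemma symmetric_quadratic_form_add:
  fixes A :: "real^'n^'n"
  assumes "transpose A = A"
  shows "(x + y) \<bullet> (A *v (x + y)) = x \<bullet> (A *v x) + 2 * (y \<bullet> (A *v x)) + y \<bullet> (A *v y)"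
proof -
  have "x \<bullet> (A *v y) = y \<bullet> (A *v x)"
    using symmetric_inner_matrix_vector[OF assms, of x y] by (simp add: inner_commute)
  then show ?thesis
    by (simp add: matrix_vector_right_distrib inner_add_left inner_add_right)
qed

text \<open>
  First-order optimality: for \<open>w = A v - l v\<close>, the gap \<open>x \<bullet> (A x) - l * (x \<bullet> x)\<close> along the line
  \<open>v + t w\<close> is a quadratic in \<open>t\<close> without constant term and with linear coefficient
  \<open>2 * (w \<bullet> w)\<close>; it can only stay nonnegative if \<open>w = 0\<close>.
\<close>

lemma rayleigh_minimiser_is_eigenvector:
  fixes A :: "real^'n^'n"
  assumes sym: "transpose A = A"
    and lower: "\<And>x. l * (x \<bullet> x) \<le> x \<bullet> (A *v x)"
    and attained: "v \<bullet> (A *v v) = l * (v \<bullet> v)"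
  shows "A *v v = l *\<^sub>R v"
proof -
  define w where "w = A *v v - l *\<^sub>R v"
  define c where "c = w \<bullet> (A *v w) - l * (w \<bullet> w)"
  define a where "a = w \<bullet> w"
  have c: "0 \<le> c"
    using lower[of w] by (simp add: c_def)
  have gap: "0 \<le> 2 * t * a + t\<^sup>2 * c" for t
  proof -
    have "w \<bullet> (A *v v) = a + l * (w \<bullet> v)"
      by (simp add: a_def w_def inner_diff_right)
    moreover have "(v + t *\<^sub>R w) \<bullet> (A *v (v + t *\<^sub>R w))
        = v \<bullet> (A *v v) + 2 * t * (w \<bullet> (A *v v)) + t\<^sup>2 * (w \<bullet> (A *v w))"
      using symmetric_quadratic_form_add[OF sym, of v "t *\<^sub>R w"]
      by (simp add: matrix_vector_mult_scaleR power2_eq_square)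
    moreover have "(v + t *\<^sub>R w) \<bullet> (v + t *\<^sub>R w)
        = v \<bullet> v + 2 * t * (w \<bullet> v) + t\<^sup>2 * (w \<bullet> w)"
      by (simp add: inner_add_left inner_add_right power2_eq_square inner_commute)
    ultimately show ?thesis
      using lower[of "v + t *\<^sub>R w"] attained by (simp add: c_def algebra_simps)
  qed
  \<comment> \<open>Dividing by \<open>c + 1\<close> rather than by \<open>c\<close> covers the case \<open>c = 0\<close>.\<close>
  have "0 \<le> (2 * (- a / (c + 1)) * a + (- a / (c + 1))\<^sup>2 * c) * (c + 1)\<^sup>2"
    using gap[of "- a / (c + 1)"] by simp
  also have "\<dots> = - (a\<^sup>2 * (c + 2))"
    using c by (simp add: field_simps power2_eq_square add_nonneg_eq_0_iff)
  finally have "a\<^sup>2 * (c + 2) \<le> 0"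
    by simp
  moreover have "0 \<le> a\<^sup>2 * (c + 2)"
    using c by simp
  ultimately have "a = 0"
    using c by auto
  then show ?thesis
    by (simp add: a_def w_def)
qed

text \<open>
  The quadratic form attains its minimum on the compact unit sphere, and a minimiser is an
  eigenvector. Applied to \<open>- A\<close>, this also bounds the form from above by an eigenvalue of \<open>A\<close>.
\<close>

lemma ex_rayleigh_minimal_eigenvalue:
  fixes A :: "('n::finite) rmat"
  assumes sym: "transpose A = A"
  shows "\<exists>l\<in>eigenvalues A. \<forall>x. l * (x \<bullet> x) \<le> x \<bullet> (A *v x)"
proof -
  have "continuous_on (sphere 0 1) (\<lambda>x. x \<bullet> (A *v x))"
    by (intro continuous_intros linear_continuous_on matrix_vector_mul_bounded_linear)
  moreover obtain u :: "real^'n" where "norm u = 1"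
    using vector_choose_size[of 1] by auto
  then have "sphere (0 :: real^'n) 1 \<noteq> {}"
    by (metis empty_iff mem_sphere_0)
  ultimately obtain v where v: "norm v = 1"
    and least: "\<And>y. norm y = 1 \<Longrightarrow> v \<bullet> (A *v v) \<le> y \<bullet> (A *v y)"
    using continuous_attains_inf[OF compact_sphere, of 0 1 "\<lambda>x. x \<bullet> (A *v x)"] by auto
  define l where "l = v \<bullet> (A *v v)"
  have lower: "l * (x \<bullet> x) \<le> x \<bullet> (A *v x)" for x
  proof (cases "x = 0")
    case False
    define y where "y = x /\<^sub>R norm x"
    have "norm y = 1"
      using False by (simp add: y_def)
    then have "l \<le> y \<bullet> (A *v y)"
      unfolding l_def by (rule least)
    moreover have "x = norm x *\<^sub>R y"
      using False by (simp add: y_def)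
    then have "x \<bullet> (A *v x) = (norm x)\<^sup>2 * (y \<bullet> (A *v y))"
      by (metis inner_scaleR_left inner_scaleR_right matrix_vector_mult_scaleR mult.assoc
          power2_eq_square)
    ultimately show ?thesis
      by (simp add: power2_norm_eq_inner[symmetric] mult.commute[of _ "(norm x)\<^sup>2"] mult_left_mono)
  qed simp
  have "v \<bullet> v = 1"
    using v by (simp add: power2_norm_eq_inner[symmetric])
  then have "A *v v = l *\<^sub>R v"
    using rayleigh_minimiser_is_eigenvector[OF sym lower, of v] by (simp add: l_def)
  moreover have "v \<noteq> 0"
    using v by auto
  ultimately show ?thesis
    using lower unfolding eigenvalues_def by blast
qed

text \<open>
  Eigenvectors for different eigenvalues are orthogonal, and a pairwise orthogonal set is finite.
  Without finiteness, \<open>Min\<close> and \<open>Max\<close> in \<open>lambda_min\<close> and \<open>lambda_max\<close> would carry no information.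
\<close>

lemma finite_eigenvalues_symmetric:
  fixes A :: "('n::finite) rmat"
  assumes sym: "transpose A = A"
  shows "finite (eigenvalues A)"
proof -
  obtain ev where ev: "\<And>l. l \<in> eigenvalues A \<Longrightarrow> ev l \<noteq> 0 \<and> A *v ev l = l *\<^sub>R ev l"
  proof -
    have "\<forall>l\<in>eigenvalues A. \<exists>v. v \<noteq> 0 \<and> A *v v = l *\<^sub>R v"
      by (simp add: eigenvalues_def)
    then show thesis
      using that by metis
  qed
  have orth: "ev k \<bullet> ev l = 0" if "k \<in> eigenvalues A" "l \<in> eigenvalues A" "k \<noteq> l" for k l
  proof -
    have "l * (ev k \<bullet> ev l) = k * (ev k \<bullet> ev l)"
      using symmetric_inner_matrix_vector[OF sym, of "ev k" "ev l"] ev that by simp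
    then show ?thesis
      using that by simp
  qed
  have inj: "inj_on ev (eigenvalues A)"
    by (rule inj_onI) (metis ev inner_eq_zero_iff orth)
  have "pairwise orthogonal (ev ` eigenvalues A)"
    using orth by (auto simp: pairwise_def orthogonal_def)
  then have "finite (ev ` eigenvalues A)"
    by (rule pairwise_orthogonal_imp_finite)
  then show ?thesis
    using inj by (rule finite_imageD)
qed

lemma lambda_min_le_quadratic_form:
  assumes sym: "transpose A = A"
  shows "lambda_min A * (x \<bullet> x) \<le> x \<bullet> (A *v x)"
proof -
  obtain l where l: "l \<in> eigenvalues A" "l * (x \<bullet> x) \<le> x \<bullet> (A *v x)"
    using ex_rayleigh_minimal_eigenvalue[OF sym] by blast
  have "lambda_min A \<le> l"
    unfolding lambda_min_def using finite_eigenvalues_symmetric[OF sym] l(1) by simp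
  then have "lambda_min A * (x \<bullet> x) \<le> l * (x \<bullet> x)"
    by (simp add: mult_right_mono)
  with l(2) show ?thesis
    by simp
qed

lemma quadratic_form_le_lambda_max:
  assumes sym: "transpose A = A"
  shows "x \<bullet> (A *v x) \<le> lambda_max A * (x \<bullet> x)"
proof -
  have neg: "(- A) *v y = - (A *v y)" for y
    by (simp add: vec_eq_iff matrix_vector_mult_def sum_negf)
  have "transpose (- A) = - A"
    using sym by (simp add: transpose_def vec_eq_iff)
  then obtain l where l: "l \<in> eigenvalues (- A)" "l * (x \<bullet> x) \<le> x \<bullet> ((- A) *v x)"
    using ex_rayleigh_minimal_eigenvalue by blast
  then have "- l \<in> eigenvalues A"
    unfolding eigenvalues_def neg by (auto simp: neg_eq_iff_add_eq_0 add_eq_0_iff)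
  then have "- l \<le> lambda_max A"
    unfolding lambda_max_def using finite_eigenvalues_symmetric[OF sym] by simp
  then have "- l * (x \<bullet> x) \<le> lambda_max A * (x \<bullet> x)"
    by (rule mult_right_mono) simp
  with l(2) show ?thesis
    by (simp add: neg)
qed

lemma spd_symmetric: "spd A \<Longrightarrow> transpose A = A"
  by (simp add: spd_def)

lemma spd_quadratic_form_nonneg: "spd A \<Longrightarrow> 0 \<le> x \<bullet> (A *v x)"
  by (cases "x = 0") (auto simp: spd_def less_imp_le)

lemma spd_quadratic_form_nonpos_imp_zero: "spd A \<Longrightarrow> x \<bullet> (A *v x) \<le> 0 \<Longrightarrow> x = 0"
  by (force simp: spd_def)

lemma spd_eigenvalue_pos:
  assumes "spd A" "l \<in> eigenvalues A"
  shows "0 < l"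
proof -
  obtain v where v: "v \<noteq> 0" "A *v v = l *\<^sub>R v"
    using assms(2) unfolding eigenvalues_def by blast
  have "0 < v \<bullet> (A *v v)"
    using assms(1) v(1) by (simp add: spd_def)
  then have "0 < l * (v \<bullet> v)"
    by (simp add: v(2))
  then show ?thesis
    using inner_ge_zero[of v] by (auto simp: zero_less_mult_iff)
qed

lemma lambda_min_pos: "spd A \<Longrightarrow> 0 < lambda_min A"
  and lambda_max_pos: "spd A \<Longrightarrow> 0 < lambda_max A"
proof -
  assume spd: "spd A"
  have "finite (eigenvalues A)" "eigenvalues A \<noteq> {}"
    using finite_eigenvalues_symmetric ex_rayleigh_minimal_eigenvalue spd_symmetric[OF spd]
    by blast+
  then show "0 < lambda_min A" "0 < lambda_max A"
    using spd_eigenvalue_pos[OF spd] unfolding lambda_min_def lambda_max_def by simp_all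
qed

lemma norm_matrix_vector_le_lambda_max:
  assumes spd: "spd A"
  shows "norm (A *v x) \<le> lambda_max A * norm x"
proof -
  note sym = spd_symmetric[OF spd]
  define L where "L = lambda_max A"
  define y where "y = A *v x"
  have L: "0 < L"
    using lambda_max_pos[OF spd] by (simp add: L_def)
  have yAy: "y \<bullet> (A *v y) \<le> L * (y \<bullet> y)"
    unfolding L_def by (rule quadratic_form_le_lambda_max[OF sym])
  have neg: "A *v (- y) = - (A *v y)"
    by (simp add: vec_eq_iff matrix_vector_mult_def sum_negf)
  \<comment> \<open>The vector \<open>x - A x / L\<close> turns the Rayleigh bound on \<open>A x\<close> into a bound on the norm of \<open>A x\<close>;
    it is scaled by \<open>L\<close> to avoid division.\<close>
  have "0 \<le> (L *\<^sub>R x + - y) \<bullet> (A *v (L *\<^sub>R x + - y))"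
    by (rule spd_quadratic_form_nonneg[OF spd])
  also have "\<dots> = L\<^sup>2 * (x \<bullet> y) - 2 * L * (y \<bullet> y) + y \<bullet> (A *v y)"
    using symmetric_quadratic_form_add[OF sym, of "L *\<^sub>R x" "- y"]
    by (simp add: matrix_vector_mult_scaleR power2_eq_square y_def[symmetric] neg inner_commute)
  also have "\<dots> \<le> L * (L * (x \<bullet> y) - y \<bullet> y)"
    using yAy by (simp add: algebra_simps power2_eq_square)
  finally have "y \<bullet> y \<le> L * (x \<bullet> y)"
    using L by (simp add: zero_le_mult_iff)
  also have "\<dots> \<le> L * (L * (x \<bullet> x))"
    using quadratic_form_le_lambda_max[OF sym, of x] L by (simp add: L_def y_def)
  finally have "(norm y)\<^sup>2 \<le> (L * norm x)\<^sup>2"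
    by (simp add: power2_norm_eq_inner power_mult_distrib power2_eq_square[of L] mult.assoc)
  then show ?thesis
    using L unfolding y_def L_def by (simp add: power2_le_iff_abs_le)
qed

section \<open>Solutions on a free set\<close>

lemma principal_mult_eq_matrix_vector:
  assumes "\<And>i. i \<notin> F \<Longrightarrow> x $ i = 0"
  shows "principal_mult A F x i = (A *v x) $ i"
  unfolding principal_mult_def matrix_vector_mult_def
  by (simp, rule sum.mono_neutral_left) (auto simp: assms)

lemma principal_mult_zero_ext: "principal_mult A F y i = (A *v zero_ext F y) $ i"
proof -
  have "principal_mult A F y i = principal_mult A F (zero_ext F y) i"
    by (simp add: principal_mult_def zero_ext_def)
  then show ?thesis
    by (simp add: principal_mult_eq_matrix_vector zero_ext_def)
qed

text \<open>
  Replacing the rows outside \<open>F\<close> by those of the identity gives an endomorphism of the whole space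
  whose kernel is trivial by definiteness of \<open>A\<close>, hence a bijection.
\<close>

lemma ex1_principal_solution:
  assumes spd: "spd A"
  shows "\<exists>!x. (\<forall>i\<in>F. principal_mult A F x i = b $ i) \<and> (\<forall>i. i \<notin> F \<longrightarrow> x $ i = 0)"
proof -
  define g where "g x = (\<chi> i. if i \<in> F then principal_mult A F x i else x $ i)" for x
  have lin: "linear g"
    by (rule linearI)
      (auto simp: g_def vec_eq_iff principal_mult_def distrib_left sum.distrib sum_distrib_left
        mult.left_commute)
  have kernel: "x = 0" if "g x = 0" for x
  proof -
    have outside: "x $ i = 0" if "i \<notin> F" for i
      using arg_cong[OF \<open>g x = 0\<close>, of "\<lambda>y. y $ i"] that by (simp add: g_def)
    have "(A *v x) $ i = 0" if "i \<in> F" for i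
      using arg_cong[OF \<open>g x = 0\<close>, of "\<lambda>y. y $ i"] that
        principal_mult_eq_matrix_vector[OF outside, where A = A and i = i] by (simp add: g_def)
    then have "x \<bullet> (A *v x) = 0"
      unfolding inner_vec_def using outside by (intro sum.neutral) (metis inner_zero_left inner_zero_right)
    then show "x = 0"
      using spd_quadratic_form_nonpos_imp_zero[OF spd] by simp
  qed
  then have inj: "inj g"
    by (simp add: linear_injective_0[OF lin])
  then have "surj g"
    using lin by (simp add: linear_injective_imp_surjective)
  then obtain x where x: "g x = zero_ext F b"
    by (metis surjD)
  have "g y = zero_ext F b \<longleftrightarrow>
      (\<forall>i\<in>F. principal_mult A F y i = b $ i) \<and> (\<forall>i. i \<notin> F \<longrightarrow> y $ i = 0)" for y
    by (auto simp: g_def zero_ext_def vec_eq_iff)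
  then show ?thesis
    using x inj by (metis injD)
qed

lemma xhat_solves: "spd A \<Longrightarrow> i \<in> F \<Longrightarrow> principal_mult A F (xhat A b F) i = b $ i"
  and xhat_zero_outside: "spd A \<Longrightarrow> i \<notin> F \<Longrightarrow> xhat A b F $ i = 0"
  using theI'[OF ex1_principal_solution[of A F b], folded xhat_def] by blast+

lemma shat_zero_inside: "spd A \<Longrightarrow> i \<in> F \<Longrightarrow> shat A b F $ i = 0"
  using principal_mult_eq_matrix_vector[of F "xhat A b F" A i] xhat_zero_outside[of A _ F b]
    xhat_solves[of A i F b]
  by (simp add: shat_def)

lemma zero_ext_xhat: "spd A \<Longrightarrow> zero_ext F (xhat A b F) = xhat A b F"
  by (simp add: zero_ext_def vec_eq_iff xhat_zero_outside)

text \<open>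
  The error \<open>e\<close> is supported in \<open>F\<close>, and there \<open>A e\<close> is minus the residual vector; so
  \<open>lambda_min A * |e|^2 \<le> e \<bullet> (A e)\<close> is at most \<open>|e|\<close> times the residual norm.
\<close>

lemma norm_error_le_residual:
  fixes A :: "('n::finite) rmat"
  assumes spd: "spd A"
  shows "norm (zero_ext F y - xhat A b F) \<le> residual A b F y / lambda_min A"
proof -
  define e where "e = zero_ext F y - xhat A b F"
  define r where "r = (\<chi> i. if i \<in> F then b $ i - principal_mult A F y i else 0)"
  have outside: "e $ i = 0" if "i \<notin> F" for i
    using that by (simp add: e_def zero_ext_def xhat_zero_outside[OF spd])
  have inside: "(A *v e) $ i = - r $ i" if "i \<in> F" for i
  proof -
    have "(A *v xhat A b F) $ i = b $ i"
      using shat_zero_inside[OF spd that, of b] by (simp add: shat_def)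
    then show ?thesis
      using that by (simp add: e_def r_def matrix_vector_mult_diff_distrib principal_mult_zero_ext)
  qed
  have norm_r: "norm r = residual A b F y"
  proof -
    have "(\<Sum>i\<in>UNIV. (r $ i)\<^sup>2) = (\<Sum>i\<in>F. (b $ i - principal_mult A F y i)\<^sup>2)"
      by (rule sum.mono_neutral_cong_right) (auto simp: r_def)
    then show ?thesis
      by (simp add: norm_vec_def residual_def L2_set_def)
  qed
  have "lambda_min A * (norm e)\<^sup>2 \<le> e \<bullet> (A *v e)"
    using lambda_min_le_quadratic_form[OF spd_symmetric[OF spd], of e]
    by (simp add: power2_norm_eq_inner)
  also have "\<dots> = e \<bullet> (- r)"
    unfolding inner_vec_def
  proof (rule sum.cong)
    show "e $ i \<bullet> (A *v e) $ i = e $ i \<bullet> (- r) $ i" for i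
      using inside outside by (cases "i \<in> F") auto
  qed simp
  also have "\<dots> \<le> norm e * norm r"
    using norm_cauchy_schwarz[of e "- r"] by simp
  finally have "norm e * (lambda_min A * norm e) \<le> norm e * norm r"
    by (simp add: power2_eq_square mult.left_commute)
  then have "lambda_min A * norm e \<le> norm r"
    by (cases "norm e = 0") (auto simp: mult_le_cancel_left_pos)
  then show ?thesis
    using lambda_min_pos[OF spd] norm_r by (simp add: e_def pos_le_divide_eq mult.commute)
qed

section \<open>Optimality of a free set without violators\<close>

lemma quad_obj_expansion:
  assumes "transpose A = A"
  shows "quad_obj A b y = quad_obj A b x + (y - x) \<bullet> (A *v x - b) + (y - x) \<bullet> (A *v (y - x)) / 2"
  using symmetric_quadratic_form_add[OF assms, of x "y - x"]
  by (simp add: quad_obj_def inner_diff_right inner_diff_left inner_commute field_simps)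

text \<open>
  In the second-order expansion of the objective around \<open>x\<close>, the linear term at a feasible \<open>z\<close> is
  \<open>z \<bullet> (A x - b) \<ge> 0\<close> by complementarity, so the objective exceeds its value at \<open>x\<close> by at least the
  quadratic term, which is positive unless \<open>z = x\<close>.
\<close>

lemma kkt_imp_unique_minimiser:
  fixes x :: "real^('n::finite)"
  assumes spd: "spd A"
    and feasible: "\<And>i. 0 \<le> x $ i"
    and dual: "\<And>i. 0 \<le> (A *v x - b) $ i"
    and compl: "\<And>i. x $ i = 0 \<or> (A *v x - b) $ i = 0"
  shows "is_nonneg_minimiser A b y \<longleftrightarrow> y = x"
proof -
  have ge: "(z - x) \<bullet> (A *v (z - x)) / 2 \<le> quad_obj A b z - quad_obj A b x"
    if "\<forall>i. 0 \<le> z $ i" for z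
  proof -
    have "0 \<le> (z $ i - x $ i) * (A *v x - b) $ i" for i
    proof -
      have "(z $ i - x $ i) * (A *v x - b) $ i = z $ i * (A *v x - b) $ i"
        using compl[of i] by auto
      also have "\<dots> \<ge> 0"
        using that dual[of i] by (intro mult_nonneg_nonneg) auto
      finally show ?thesis .
    qed
    then have "0 \<le> (z - x) \<bullet> (A *v x - b)"
      unfolding inner_vec_def by (intro sum_nonneg) simp
    then show ?thesis
      using quad_obj_expansion[OF spd_symmetric[OF spd], of b z x] by simp
  qed
  have least: "quad_obj A b x \<le> quad_obj A b z" if "\<forall>i. 0 \<le> z $ i" for z
    using ge[OF that] spd_quadratic_form_nonneg[OF spd, of "z - x"] by simp
  show ?thesis
  proof
    assume "is_nonneg_minimiser A b y"
    then have y: "\<forall>i. 0 \<le> y $ i" "quad_obj A b y \<le> quad_obj A b x"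
      using feasible by (auto simp: is_nonneg_minimiser_def is_arg_min_def not_less)
    then have "(y - x) \<bullet> (A *v (y - x)) \<le> 0"
      using ge[OF y(1)] by simp
    then show "y = x"
      using spd_quadratic_form_nonpos_imp_zero[OF spd, of "y - x"] by simp
  next
    assume "y = x"
    then show "is_nonneg_minimiser A b y"
      using feasible least by (force simp: is_nonneg_minimiser_def is_arg_min_def not_less)
  qed
qed

text \<open>
  In the language of linear complementarity these are the values of the basic variables of the
  complementary basis given by \<open>F\<close>; the other entries of \<open>xhat\<close> and \<open>shat\<close> vanish.
\<close>

definition decision_value :: "('n::finite) rmat \<Rightarrow> 'n rvec \<Rightarrow> 'n set \<Rightarrow> 'n \<Rightarrow> real" where
  "decision_value A b F i = (if i \<in> F then xhat A b F $ i else shat A b F $ i)"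

lemma exact_violators:
  "drop_violators 0 F (xhat A b F) \<union> add_violators 0 F (shat A b F)
     = {i. decision_value A b F i < 0}"
  by (auto simp: drop_violators_def add_violators_def decision_value_def)

lemma no_violators_imp_unique_minimiser:
  assumes spd: "spd A" and nonneg: "\<And>i. 0 \<le> decision_value A b F i"
  shows "is_nonneg_minimiser A b y \<longleftrightarrow> y = xhat A b F"
proof (rule kkt_imp_unique_minimiser[OF spd])
  fix i
  show "0 \<le> xhat A b F $ i"
    using nonneg[of i] xhat_zero_outside[OF spd, of i F b]
    by (cases "i \<in> F") (auto simp: decision_value_def)
  show "0 \<le> (A *v xhat A b F - b) $ i"
    using nonneg[of i] shat_zero_inside[OF spd, of i F b] unfolding shat_def[symmetric]
    by (cases "i \<in> F") (auto simp: decision_value_def)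
  show "xhat A b F $ i = 0 \<or> (A *v xhat A b F - b) $ i = 0"
    using xhat_zero_outside[OF spd, of i F b] shat_zero_inside[OF spd, of i F b]
    unfolding shat_def by blast
qed

section \<open>Finite termination of the exact loop\<close>

text \<open>
  The heart of Murty's least-index argument. With \<open>x, s\<close> belonging to \<open>F\<close> and \<open>y, t\<close> to \<open>G\<close>, the
  number \<open>(x - y) \<bullet> A (x - y) = (x - y) \<bullet> (s - t)\<close> is nonnegative. But its summands vanish above
  \<open>m\<close>, are nonpositive below \<open>m\<close>, and at \<open>m\<close> the summand is \<open>(- y m) * s m\<close> with \<open>y m\<close> and \<open>s m\<close>
  both negative.
\<close>

lemma least_violator_cannot_enter_and_leave:
  fixes A :: "('n::{finite,linorder}) rmat"
  assumes spd: "spd A"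
    and "m \<notin> F" "m \<in> G" and above: "\<And>j. m < j \<Longrightarrow> j \<in> F \<longleftrightarrow> j \<in> G"
    and F: "decision_value A b F m < 0" "\<And>j. j < m \<Longrightarrow> 0 \<le> decision_value A b F j"
    and G: "decision_value A b G m < 0" "\<And>j. j < m \<Longrightarrow> 0 \<le> decision_value A b G j"
  shows False
proof -
  define x y s t where "x = xhat A b F" and "y = xhat A b G"
    and "s = shat A b F" and "t = shat A b G"
  define d where "d = x - y"
  have x: "\<And>i. i \<notin> F \<Longrightarrow> x $ i = 0" and y: "\<And>i. i \<notin> G \<Longrightarrow> y $ i = 0"
    and s: "\<And>i. i \<in> F \<Longrightarrow> s $ i = 0" and t: "\<And>i. i \<in> G \<Longrightarrow> t $ i = 0"
    by (simp_all add: x_def y_def s_def t_def xhat_zero_outside[OF spd] shat_zero_inside[OF spd])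
  have Ad: "A *v d = s - t"
    by (simp add: d_def s_def t_def x_def y_def shat_def matrix_vector_mult_diff_distrib)
  have at_m: "d $ m * (s - t) $ m < 0"
  proof -
    have "s $ m < 0" "y $ m < 0"
      using F(1) G(1) \<open>m \<notin> F\<close> \<open>m \<in> G\<close> by (simp_all add: decision_value_def s_def y_def)
    then show ?thesis
      using x[OF \<open>m \<notin> F\<close>] t[OF \<open>m \<in> G\<close>] by (simp add: d_def mult_neg_neg mult_pos_neg)
  qed
  have le: "d $ i * (s - t) $ i \<le> 0" for i
  proof (cases i m rule: linorder_cases)
    case less
    \<comment> \<open>Below \<open>m\<close> both points are nonnegative and complementary, so only cross products remain.\<close>
    have xs: "0 \<le> x $ i" "0 \<le> s $ i" "x $ i * s $ i = 0"
      using F(2)[OF less] x[of i] s[of i] unfolding x_def[symmetric] s_def[symmetric]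
        decision_value_def by (auto split: if_splits)
    have yt: "0 \<le> y $ i" "0 \<le> t $ i" "y $ i * t $ i = 0"
      using G(2)[OF less] y[of i] t[of i] unfolding y_def[symmetric] t_def[symmetric]
        decision_value_def by (auto split: if_splits)
    have "d $ i * (s - t) $ i = x $ i * s $ i - x $ i * t $ i - y $ i * s $ i + y $ i * t $ i"
      by (simp add: d_def algebra_simps)
    moreover have "0 \<le> x $ i * t $ i" "0 \<le> y $ i * s $ i"
      using xs yt by simp_all
    moreover note xs(3) yt(3)
    ultimately show ?thesis
      by linarith
  next
    case equal
    then show ?thesis
      using at_m by simp
  next
    case greater
    then show ?thesis
      using above[OF greater] x[of i] y[of i] s[of i] t[of i] by (cases "i \<in> F") (auto simp: d_def)
  qed
  have "d \<bullet> (A *v d) = (\<Sum>i\<in>UNIV. d $ i * (s - t) $ i)"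
    by (simp add: Ad inner_vec_def)
  also have "\<dots> < (\<Sum>i\<in>(UNIV::'n set). 0)"
    by (rule sum_strict_mono_ex1) (use le at_m in auto)
  finally show False
    using spd_quadratic_form_nonneg[OF spd, of d] by simp
qed

text \<open>
  The largest index \<open>m\<close> that is toggled infinitely often does the job: from some time \<open>B\<close> on nothing
  above \<open>m\<close> is toggled, and after \<open>B\<close> the toggles of \<open>m\<close> alternate between entering and leaving.
\<close>

lemma toggling_enters_and_leaves:
  fixes F :: "nat \<Rightarrow> ('n::{finite,linorder}) set" and c :: "nat \<Rightarrow> 'n"
  assumes toggle: "\<And>t j. (j \<in> F (Suc t) \<longleftrightarrow> j \<in> F t) \<longleftrightarrow> j \<noteq> c t"
  obtains t u where "c u = c t" "c t \<notin> F t" "c t \<in> F u" "\<And>j. c t < j \<Longrightarrow> j \<in> F t \<longleftrightarrow> j \<in> F u"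
proof -
  define I where "I = {i. infinite {t. c t = i}}"
  have "I \<noteq> {}"
    using pigeonhole_infinite[of "UNIV :: nat set" c] by (auto simp: I_def)
  define m where "m = Max I"
  have "m \<in> I"
    using \<open>I \<noteq> {}\<close> by (simp add: m_def)
  have fin: "finite {t. c t = j}" if "m < j" for j
  proof (rule ccontr)
    assume "infinite {t. c t = j}"
    then have "j \<le> m"
      unfolding m_def by (intro Max_ge) (auto simp: I_def)
    then show False
      using that by simp
  qed
  have "{t. m < c t} = (\<Union>j\<in>{m<..}. {t. c t = j})"
    by auto
  then have "finite {t. m < c t}"
    using fin by simp
  then obtain B where B: "\<And>t. B \<le> t \<Longrightarrow> \<not> m < c t"
    unfolding finite_nat_set_iff_bounded by (metis mem_Collect_eq not_less)
  have above: "j \<in> F t \<longleftrightarrow> j \<in> F B" if "m < j" "B \<le> t" for j t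
    using \<open>B \<le> t\<close>
  proof (induction t rule: dec_induct)
    case (step t)
    then show ?case
      using B[of t] toggle[of j t] that(1) by auto
  qed simp
  have recur: "\<exists>t\<ge>k. c t = m" for k
    using \<open>m \<in> I\<close> unfolding I_def infinite_nat_iff_unbounded_le by blast
  have "\<exists>t\<ge>B. \<exists>u\<ge>B. c t = m \<and> c u = m \<and> m \<notin> F t \<and> m \<in> F u"
  proof (rule ccontr)
    assume "\<not> ?thesis"
    then have same: "m \<in> F t \<longleftrightarrow> m \<in> F u" if "B \<le> t" "B \<le> u" "c t = m" "c u = m" for t u
      using that by blast
    obtain t where t: "B \<le> t" "c t = m"
      using recur by blast
    \<comment> \<open>If all late toggles of \<open>m\<close> went the same way, the first one would be the last one.\<close>
    have stuck: "m \<in> F u \<longleftrightarrow> m \<notin> F t" if "Suc t \<le> u" for u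
      using that
    proof (induction u rule: dec_induct)
      case base
      then show ?case
        using toggle[of m t] t by blast
    next
      case (step u)
      then have "c u \<noteq> m"
        using same[of t u] t by auto
      then show ?case
        using toggle[of m u] step by blast
    qed
    obtain u where "Suc t \<le> u" "c u = m"
      using recur by blast
    then show False
      using stuck[of u] same[of t u] t by auto
  qed
  then obtain t u where tu: "B \<le> t" "B \<le> u" "c t = m" "c u = m" "m \<notin> F t" "m \<in> F u"
    by blast
  show ?thesis
  proof (rule that[of u t])
    show "j \<in> F t \<longleftrightarrow> j \<in> F u" if "c t < j" for j
      using above[of j t] above[of j u] tu that by simp
  qed (use tu in simp_all)
qed

lemma least_index_pivoting_terminates:
  fixes A :: "('n::{finite,linorder}) rmat"
  assumes spd: "spd A"
    and violated: "\<And>t. {i. decision_value A b (F t) i < 0} \<noteq> {}"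
    and toggle: "\<And>t j. (j \<in> F (Suc t) \<longleftrightarrow> j \<in> F t) \<longleftrightarrow> j \<noteq> Min {i. decision_value A b (F t) i < 0}"
  shows False
proof -
  define c where "c t = Min {i. decision_value A b (F t) i < 0}" for t
  have neg: "decision_value A b (F t) (c t) < 0" for t
    using Min_in[OF _ violated[of t]] by (simp add: c_def)
  have below: "0 \<le> decision_value A b (F t) j" if "j < c t" for t j
  proof (rule ccontr)
    assume "\<not> ?thesis"
    then have "c t \<le> j"
      unfolding c_def by (intro Min_le) auto
    then show False
      using that by simp
  qed
  show False
  proof (rule toggling_enters_and_leaves[of F c])
    show "(j \<in> F (Suc t) \<longleftrightarrow> j \<in> F t) \<longleftrightarrow> j \<noteq> c t" for t j
      unfolding c_def by (rule toggle)
    fix t u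
    assume same: "c u = c t" and tu: "c t \<notin> F t" "c t \<in> F u"
      "\<And>j. c t < j \<Longrightarrow> j \<in> F t \<longleftrightarrow> j \<in> F u"
    show False
      by (rule least_violator_cannot_enter_and_leave[OF spd tu neg below
            neg[of u, unfolded same] below[of _ u, unfolded same]])
  qed
qed

text \<open>
  Block steps lower the pair (best, budget): either a new best count is found, which may reset the
  budget, or the budget is spent. Only least-index steps keep the pair, and these toggle one index.
\<close>

lemma next_state_progress:
  assumes step: "next_state pmax D V st = Some st'"
    and D: "D \<subseteq> free st" and V: "V \<inter> free st = {}"
  shows "D \<union> V \<noteq> {}"
    and "((best st', budget st'), (best st, budget st)) \<in> less_than <*lex*> less_than \<or>
      (best st', budget st') = (best st, budget st) \<and>
      (\<forall>j. (j \<in> free st' \<longleftrightarrow> j \<in> free st) \<longleftrightarrow> j \<noteq> Min (D \<union> V))"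
proof -
  show ne: "D \<union> V \<noteq> {}"
    using step by (auto simp: next_state_def)
  have "Min (D \<union> V) \<in> D \<union> V"
    using ne by (intro Min_in) auto
  then have m: "Min (D \<union> V) \<in> D \<longleftrightarrow> Min (D \<union> V) \<in> free st"
    using D V by blast
  show "((best st', budget st'), (best st, budget st)) \<in> less_than <*lex*> less_than \<or>
      (best st', budget st') = (best st, budget st) \<and>
      (\<forall>j. (j \<in> free st' \<longleftrightarrow> j \<in> free st) \<longleftrightarrow> j \<noteq> Min (D \<union> V))"
    using step m by (auto simp: next_state_def Let_def split: if_splits)
qed

lemma exact_run_Suc:
  assumes "spd A" "exact_run A b pmax t = Some st"
  shows "exact_run A b pmax (Suc t) =
    next_state pmax (drop_violators 0 (free st) (xhat A b (free st)))
      (add_violators 0 (free st) (shat A b (free st))) st"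
  using assms by (simp add: exact_run_def zero_ext_xhat shat_def Let_def)

lemma exact_run_terminates:
  fixes A :: "('n::{finite,linorder}) rmat"
  assumes spd: "spd A"
  shows "\<exists>t. exact_run A b pmax (Suc t) = None"
proof (rule ccontr)
  assume "\<not> ?thesis"
  then have running: "exact_run A b pmax (Suc t) \<noteq> None" for t
    by metis
  define st where "st t = the (exact_run A b pmax t)" for t
  have st: "exact_run A b pmax t = Some (st t)" for t
  proof (cases t)
    case 0
    then show ?thesis
      by (simp add: st_def exact_run_def)
  next
    case (Suc k)
    then show ?thesis
      using running[of k] by (auto simp: st_def)
  qed
  define rank where "rank t = (best (st t), budget (st t))" for t
  have step: "next_state pmax (drop_violators 0 (free (st t)) (xhat A b (free (st t))))
      (add_violators 0 (free (st t)) (shat A b (free (st t)))) (st t) = Some (st (Suc t))" for t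
    using exact_run_Suc[OF spd st[of t]] st[of "Suc t"] by simp
  have D: "drop_violators 0 (free (st t)) (xhat A b (free (st t))) \<subseteq> free (st t)"
    and V: "add_violators 0 (free (st t)) (shat A b (free (st t))) \<inter> free (st t) = {}" for t
    by (auto simp: drop_violators_def add_violators_def)
  note progress = next_state_progress[OF step D V, unfolded exact_violators]
  have wf: "wf (less_than <*lex*> less_than)"
    by auto
  \<comment> \<open>From a time with minimal rank on, the rank is constant, so only least-index steps remain.\<close>
  obtain t0 where t0: "\<And>t. (rank t, rank t0) \<notin> less_than <*lex*> less_than"
    using wfE_min[OF wf, of "rank 0" "range rank"] by (metis rangeE rangeI)
  have rank: "rank t = rank t0" if "t0 \<le> t" for t
    using that
  proof (induction t rule: dec_induct)
    case (step t)
    then show ?case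
      using progress(2)[of t] t0[of "Suc t"] by (auto simp: rank_def)
  qed simp
  define F where "F k = free (st (t0 + k))" for k
  have "(j \<in> F (Suc k) \<longleftrightarrow> j \<in> F k) \<longleftrightarrow> j \<noteq> Min {i. decision_value A b (F k) i < 0}" for k j
    using progress(2)[of "t0 + k"] rank[of "t0 + k"] rank[of "Suc (t0 + k)"]
    by (auto simp: rank_def F_def)
  moreover have "{i. decision_value A b (F k) i < 0} \<noteq> {}" for k
    using progress(1)[of "t0 + k"] by (simp add: F_def)
  ultimately show False
    using least_index_pivoting_terminates[OF spd, of b F] by blast
qed

lemma exact_run_Some_iff:
  assumes "spd A"
  shows "exact_run A b pmax t \<noteq> None \<longleftrightarrow> t \<le> exact_stop A b pmax"
proof -
  have stop: "exact_run A b pmax (Suc (exact_stop A b pmax)) = None"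
    unfolding exact_stop_def by (rule LeastI_ex[OF exact_run_terminates[OF assms]])
  have "exact_run A b pmax t = None" if "Suc (exact_stop A b pmax) \<le> t"
    using that
  proof (induction t rule: dec_induct)
    case base
    show ?case by (rule stop)
  next
    case (step t)
    then show ?case by (simp add: exact_run_def)
  qed
  moreover have "exact_run A b pmax t \<noteq> None" if "t \<le> exact_stop A b pmax"
  proof (cases t)
    case 0
    then show ?thesis by (simp add: exact_run_def)
  next
    case (Suc k)
    then have "k < exact_stop A b pmax"
      using that by simp
    then show ?thesis
      unfolding Suc exact_stop_def by (rule not_less_Least)
  qed
  ultimately show ?thesis
    by (meson not_less_eq_eq)
qed

lemma exact_stop_no_violators:
  assumes spd: "spd A"
  shows "0 \<le> decision_value A b (exact_free A b pmax (exact_stop A b pmax)) i"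
proof -
  define T where "T = exact_stop A b pmax"
  obtain st where st: "exact_run A b pmax T = Some st"
    using exact_run_Some_iff[OF spd, of b pmax T] by (auto simp: T_def)
  have "exact_run A b pmax (Suc T) = None"
    using exact_run_Some_iff[OF spd, of b pmax "Suc T"] by (auto simp: T_def)
  then have "{i. decision_value A b (free st) i < 0} = {}"
    unfolding exact_run_Suc[OF spd st] next_state_def exact_violators
    by (auto simp: Let_def split: if_splits)
  then show ?thesis
    using st by (auto simp: T_def exact_free_def not_less[symmetric])
qed

section \<open>The decision margin\<close>

lemma decision_margin_eq:
  "decision_margin A b pmax =
    (INF t\<in>{0..exact_stop A b pmax}.
      Inf ((\<lambda>i. ereal \<bar>decision_value A b (exact_free A b pmax t) i\<bar>) `
        {i. decision_value A b (exact_free A b pmax t) i \<noteq> 0}))"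
proof -
  have "{ereal \<bar>xhat A b F $ i\<bar> |i. i \<in> F \<and> xhat A b F $ i \<noteq> 0} \<union>
        {ereal \<bar>shat A b F $ i\<bar> |i. i \<notin> F \<and> shat A b F $ i \<noteq> 0} =
      (\<lambda>i. ereal \<bar>decision_value A b F i\<bar>) ` {i. decision_value A b F i \<noteq> 0}" for F
  proof -
    let ?g = "\<lambda>i. ereal \<bar>decision_value A b F i\<bar>"
    have inside: "{ereal \<bar>xhat A b F $ i\<bar> |i. i \<in> F \<and> xhat A b F $ i \<noteq> 0} =
        ?g ` {i. i \<in> F \<and> decision_value A b F i \<noteq> 0}"
      unfolding setcompr_eq_image by (rule image_cong) (auto simp: decision_value_def)
    have outside: "{ereal \<bar>shat A b F $ i\<bar> |i. i \<notin> F \<and> shat A b F $ i \<noteq> 0} =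
        ?g ` {i. i \<notin> F \<and> decision_value A b F i \<noteq> 0}"
      unfolding setcompr_eq_image by (rule image_cong) (auto simp: decision_value_def)
    show ?thesis
      unfolding inside outside image_Un[symmetric] by (rule arg_cong[of _ _ "image ?g"]) auto
  qed
  then show ?thesis
    by (simp add: decision_margin_def Let_def)
qed

lemma decision_margin_le:
  assumes "t \<le> exact_stop A b pmax" "decision_value A b (exact_free A b pmax t) i \<noteq> 0"
  shows "decision_margin A b pmax \<le> ereal \<bar>decision_value A b (exact_free A b pmax t) i\<bar>"
  unfolding decision_margin_eq by (rule INF_lower2[of t]) (use assms in \<open>auto intro!: INF_lower\<close>)

lemma finite_Inf_pos:
  fixes S :: "ereal set"
  assumes "finite S" "\<And>x. x \<in> S \<Longrightarrow> 0 < x"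
  shows "0 < Inf S"
proof (cases "S = {}")
  case False
  then show ?thesis
    using assms by (simp flip: Min_Inf)
qed (simp add: top_ereal_def)

lemma decision_margin_pos: "0 < decision_margin A b pmax"
  unfolding decision_margin_eq by (intro finite_Inf_pos) (auto intro!: finite_Inf_pos)

section \<open>Stability of the decisions under inexact solves\<close>

text \<open>
  The threshold \<open>- eps\<close> separates the perturbed values: those of nonnegative \<open>v\<close> exceed \<open>- eps\<close>
  because the error is below \<open>eps\<close>, and those of negative \<open>v\<close>, where \<open>v \<le> - mu\<close>, are less than
  \<open>- mu + (mu - eps)\<close>.
\<close>

lemma violation_test_stable:
  fixes v w eps err :: real and mu :: ereal
  assumes close: "\<bar>w - v\<bar> \<le> err" and err: "ereal err < min (ereal eps) (mu - ereal eps)"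
    and margin: "v \<noteq> 0 \<Longrightarrow> mu \<le> ereal \<bar>v\<bar>"
  shows "w < - eps \<longleftrightarrow> v < 0"
proof
  assume "w < - eps"
  then show "v < 0"
    using close err by auto
next
  assume v: "v < 0"
  have "ereal err < mu - ereal eps"
    using err by simp
  also have "\<dots> \<le> ereal \<bar>v\<bar> - ereal eps"
    using margin v by (intro ereal_minus_mono) auto
  finally show "w < - eps"
    using close v by simp
qed

text \<open>
  The factor \<open>1 + lambda_max A\<close> is a common bound for the amplification of the primal error
  (factor \<open>1\<close>) and of the dual error (factor \<open>lambda_max A\<close>).
\<close>

lemma solve_error_le:
  fixes A :: "('n::finite) rmat"
  assumes spd: "spd A"
  defines "bound y F b \<equiv> residual A b F y * ((1 + lambda_max A) / lambda_min A)"
  shows "\<bar>zero_ext F y $ i - xhat A b F $ i\<bar> \<le> bound y F b"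
    and "\<bar>(A *v zero_ext F y - b) $ i - shat A b F $ i\<bar> \<le> bound y F b"
proof -
  define e where "e = zero_ext F y - xhat A b F"
  define r where "r = residual A b F y / lambda_min A"
  have e: "norm e \<le> r"
    unfolding e_def r_def by (rule norm_error_le_residual[OF spd])
  then have r: "0 \<le> r"
    using norm_ge_zero order_trans by blast
  have L: "0 < lambda_max A"
    by (rule lambda_max_pos[OF spd])
  have bound: "bound y F b = r + lambda_max A * r"
    by (simp add: bound_def r_def algebra_simps add_divide_distrib)
  have "\<bar>e $ i\<bar> \<le> r"
    using component_le_norm_cart[of e i] e by simp
  then show "\<bar>zero_ext F y $ i - xhat A b F $ i\<bar> \<le> bound y F b"
    using r L by (simp add: bound e_def add_increasing2)
  have "\<bar>(A *v e) $ i\<bar> \<le> lambda_max A * norm e"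
    using component_le_norm_cart[of "A *v e" i] norm_matrix_vector_le_lambda_max[OF spd, of e]
    by simp
  also have "\<dots> \<le> lambda_max A * r"
    using e L by simp
  finally show "\<bar>(A *v zero_ext F y - b) $ i - shat A b F $ i\<bar> \<le> bound y F b"
    using r by (simp add: bound e_def shat_def matrix_vector_mult_diff_distrib)
qed

lemma inexact_violators_eq:
  assumes spd: "spd A"
    and margin: "\<And>i. decision_value A b F i \<noteq> 0 \<Longrightarrow> mu \<le> ereal \<bar>decision_value A b F i\<bar>"
    and small: "ereal (residual A b F y * ((1 + lambda_max A) / lambda_min A))
      < min (ereal eps) (mu - ereal eps)"
  shows "drop_violators eps F (zero_ext F y) = drop_violators 0 F (xhat A b F)"
    and "add_violators eps F (A *v zero_ext F y - b) = add_violators 0 F (shat A b F)"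
proof -
  have "zero_ext F y $ i < - eps \<longleftrightarrow> xhat A b F $ i < 0" if "i \<in> F" for i
    using violation_test_stable[OF solve_error_le(1)[OF spd] small] margin[of i] that
    by (simp add: decision_value_def)
  then show "drop_violators eps F (zero_ext F y) = drop_violators 0 F (xhat A b F)"
    by (auto simp: drop_violators_def)
  have "(A *v zero_ext F y - b) $ i < - eps \<longleftrightarrow> shat A b F $ i < 0" if "i \<notin> F" for i
    using violation_test_stable[OF solve_error_le(2)[OF spd] small] margin[of i] that
    by (simp add: decision_value_def)
  then show "add_violators eps F (A *v zero_ext F y - b) = add_violators 0 F (shat A b F)"
    unfolding add_violators_def by auto
qed

text \<open>
  The margin covers only free sets of the exact run, so agreement of the violator sets at iteration
  \<open>t\<close> needs agreement of the states up to \<open>t\<close>, and in turn yields it at \<open>t + 1\<close>.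
\<close>

lemma inexact_run_eq_exact_run:
  fixes A :: "('n::{finite,linorder}) rmat"
  assumes spd: "spd A"
    and small: "\<And>t st. run A b eps pmax solve t = Some st \<Longrightarrow>
      ereal (residual A b (free st) (solve t (free st)) * ((1 + lambda_max A) / lambda_min A))
        < min (ereal eps) (decision_margin A b pmax - ereal eps)"
  shows "run A b eps pmax solve t = exact_run A b pmax t"
    and "run A b eps pmax solve t = Some st \<Longrightarrow>
      drop_violators eps (free st) (zero_ext (free st) (solve t (free st)))
        = drop_violators 0 (free st) (xhat A b (free st)) \<and>
      add_violators eps (free st) (A *v zero_ext (free st) (solve t (free st)) - b)
        = add_violators 0 (free st) (shat A b (free st))"
proof -
  have tests: "drop_violators eps (free st) (zero_ext (free st) (solve t (free st)))
        = drop_violators 0 (free st) (xhat A b (free st)) \<and>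
      add_violators eps (free st) (A *v zero_ext (free st) (solve t (free st)) - b)
        = add_violators 0 (free st) (shat A b (free st))"
    if inexact: "run A b eps pmax solve t = Some st" and exact: "exact_run A b pmax t = Some st"
    for t st
  proof -
    have "t \<le> exact_stop A b pmax" and "free st = exact_free A b pmax t"
      using exact exact_run_Some_iff[OF spd, of b pmax t] by (auto simp: exact_free_def)
    then have "decision_margin A b pmax \<le> ereal \<bar>decision_value A b (free st) i\<bar>"
      if "decision_value A b (free st) i \<noteq> 0" for i
      using that decision_margin_le by simp
    then show ?thesis
      using inexact_violators_eq[OF spd _ small[OF inexact]] by blast
  qed
  show eq: "run A b eps pmax solve t = exact_run A b pmax t" for t
  proof (induction t)
    case 0
    then show ?case
      by (simp add: exact_run_def)
  next
    case (Suc t)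
    show ?case
    proof (cases "exact_run A b pmax t")
      case None
      then show ?thesis
        using Suc by (simp add: exact_run_def)
    next
      case (Some st)
      then show ?thesis
        using Suc tests[of t st] exact_run_Suc[OF spd Some] by (simp add: Let_def)
    qed
  qed
  show "run A b eps pmax solve t = Some st \<Longrightarrow>
      drop_violators eps (free st) (zero_ext (free st) (solve t (free st)))
        = drop_violators 0 (free st) (xhat A b (free st)) \<and>
      add_violators eps (free st) (A *v zero_ext (free st) (solve t (free st)) - b)
        = add_violators 0 (free st) (shat A b (free st))"
    using tests[of t st] eq[of t] by simp
qed

theorem lemma4p1:
  fixes A :: "('n::{finite,linorder}) rmat" and b :: "'n rvec" and pmax :: nat
  assumes "spd A"
  shows
    "(\<exists>!x. is_nonneg_minimiser A b x) \<and>
     (\<exists>t. exact_run A b pmax (Suc t) = None) \<and>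
     0 < decision_margin A b pmax \<and>
     (\<forall>(eps::real) (solve :: nat \<Rightarrow> 'n set \<Rightarrow> 'n rvec).
        0 < eps \<longrightarrow>
        ereal eps < decision_margin A b pmax \<longrightarrow>
        (\<forall>t st. run A b eps pmax solve t = Some st \<longrightarrow>
           ereal (residual A b (free st) (solve t (free st))
                    * ((1 + lambda_max A) / lambda_min A))
             < min (ereal eps) (decision_margin A b pmax - ereal eps)) \<longrightarrow>
        (\<forall>t st. run A b eps pmax solve t = Some st \<longrightarrow>
           (let F = free st; x = zero_ext F (solve t F) in
              drop_violators eps F x = drop_violators 0 F (xhat A b F) \<and>
              add_violators eps F (A *v x - b) = add_violators 0 F (shat A b F))) \<and>
        (let T = exact_stop A b pmax;
             F = exact_free A b pmax T;
             x = zero_ext F (solve T F);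
             rho = residual A b F (solve T F)
         in
           (\<forall>t\<le>T. \<exists>st. run A b eps pmax solve t = Some st \<and> free st = exact_free A b pmax t) \<and>
           run A b eps pmax solve (Suc T) = None \<and>
           norm (x - nonneg_minimiser A b) \<le> rho / lambda_min A \<and>
           infnorm (x - nonneg_minimiser A b) \<le> rho / lambda_min A))"
proof (intro conjI allI impI)
  define T where "T = exact_stop A b pmax"
  define F where "F = exact_free A b pmax T"
  have opt: "is_nonneg_minimiser A b y \<longleftrightarrow> y = xhat A b F" for y
    unfolding F_def T_def
    by (rule no_violators_imp_unique_minimiser[OF assms exact_stop_no_violators[OF assms]])
  then show "\<exists>!x. is_nonneg_minimiser A b x"
    by simp
  have minimiser: "nonneg_minimiser A b = xhat A b F"
    by (simp add: nonneg_minimiser_def opt)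
  show "\<exists>t. exact_run A b pmax (Suc t) = None"
    by (rule exact_run_terminates[OF assms])
  show "0 < decision_margin A b pmax"
    by (rule decision_margin_pos)
  fix eps :: real and solve :: "nat \<Rightarrow> 'n set \<Rightarrow> 'n rvec"
  assume small: "\<forall>t st. run A b eps pmax solve t = Some st \<longrightarrow>
           ereal (residual A b (free st) (solve t (free st))
                    * ((1 + lambda_max A) / lambda_min A))
             < min (ereal eps) (decision_margin A b pmax - ereal eps)"
  have run_eq: "run A b eps pmax solve t = exact_run A b pmax t" for t
    by (rule inexact_run_eq_exact_run(1)[OF assms]) (use small in blast)
  show "let F = free st; x = zero_ext F (solve t F) in
              drop_violators eps F x = drop_violators 0 F (xhat A b F) \<and>
              add_violators eps F (A *v x - b) = add_violators 0 F (shat A b F)"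
    if "run A b eps pmax solve t = Some st" for t st
    unfolding Let_def by (rule inexact_run_eq_exact_run(2)[OF assms _ that]) (use small in blast)
  have visits: "\<exists>st. run A b eps pmax solve t = Some st \<and> free st = exact_free A b pmax t"
    if "t \<le> T" for t
    using that exact_run_Some_iff[OF assms, of b pmax t] by (auto simp: run_eq T_def exact_free_def)
  have stops: "run A b eps pmax solve (Suc T) = None"
    using exact_run_Some_iff[OF assms, of b pmax "Suc T"] unfolding run_eq T_def by auto
  have error: "norm (zero_ext F (solve T F) - nonneg_minimiser A b)
      \<le> residual A b F (solve T F) / lambda_min A"
    unfolding minimiser by (rule norm_error_le_residual[OF assms])
  show "let T = exact_stop A b pmax;
             F = exact_free A b pmax T;
             x = zero_ext F (solve T F);
             rho = residual A b F (solve T F)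
         in
           (\<forall>t\<le>T. \<exists>st. run A b eps pmax solve t = Some st \<and> free st = exact_free A b pmax t) \<and>
           run A b eps pmax solve (Suc T) = None \<and>
           norm (x - nonneg_minimiser A b) \<le> rho / lambda_min A \<and>
           infnorm (x - nonneg_minimiser A b) \<le> rho / lambda_min A"
    unfolding Let_def T_def[symmetric] F_def[symmetric]
    using visits stops error order_trans[OF infnorm_le_norm error] by blast
qed

end
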